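(* Let $m<n$ be positive integers, let $A\in\mathbb{R}^{n\times n}$ be symmetric positive semidefinite with $\operatorname{rank}(A)=n-m$, let $B\in\mathbb{R}^{m\times n}$ have full row rank, and suppose that the matrix $$\mathcal{K}=\begin{bmatrix}A & B^T\\ B & 0\end{bmatrix}\in\mathbb{R}^{(n+m)\times(n+m)}$$ is invertible. Let $\mu_{\min}^+$ denote the smallest nonzero eigenvalue of $A$, let $\sigma_{\min}$ denote the smallest singular value of $B$, and let $\psi_{\min}$ denote the minimum principal angle between $\ker(A)$ and $\ker(B)$. Then every positive eigenvalue of $\mathcal{K}$ is greater than or equal to $$\min\left\{\mu_{\min}^+\,(1-\cos(\psi_{\min})),\ \sigma_{\min}\sqrt{1-\cos(\psi_{\min})}\right\}.$$
   Context: The singular values of $B\in\mathbb{R}^{m\times n}$ (with $m<n$) are its $m$ singular values $\sigma_1\ge\cdots\ge\sigma_m\ge 0$, and $\sigma_{\min}=\sigma_m$. For nonzero subspaces $X,Y\subseteq\mathbb{R}^n$ with matrices $U$, $V$ whose columns are orthonormal bases of $X$ and $Y$, the cosines of the principal angles (in $[0,\pi/2]$) between $X$ and $Y$ are the singular values of $U^TV$; thus the minimum principal angle $\psi_{\min}$ satisfies $\cos(\psi_{\min})=\|U^TV\|_2$, the largest singular value of $U^TV$. *)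

theory Defs
  imports "HOL-Analysis.Analysis"
begin

definition eigenvalue :: "real^'n^'n \<Rightarrow> real \<Rightarrow> bool" where
  "eigenvalue M c \<longleftrightarrow> (\<exists>v. v \<noteq> 0 \<and> M *v v = c *\<^sub>R v)"

definition positive_semidefinite :: "real^'n^'n \<Rightarrow> bool" where
  "positive_semidefinite M \<longleftrightarrow> transpose M = M \<and> (\<forall>x. 0 \<le> x \<bullet> (M *v x))"

definition matrix_kernel :: "real^'n^'m \<Rightarrow> (real^'n) set" where
  "matrix_kernel M = {x. M *v x = 0}"

definition block_matrix ::
  "real^'n^'k \<Rightarrow> real^'m^'k \<Rightarrow> real^'n^'l \<Rightarrow> real^'m^'l \<Rightarrow> real^('n + 'm)^('k + 'l)" where
  "block_matrix P Q R S =
    (\<chi> i j. case i of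
        Inl a \<Rightarrow> (case j of Inl b \<Rightarrow> P $ a $ b | Inr b \<Rightarrow> Q $ a $ b)
      | Inr a \<Rightarrow> (case j of Inl b \<Rightarrow> R $ a $ b | Inr b \<Rightarrow> S $ a $ b))"

(* The min(m, n) singular values of an m x n matrix, without multiplicities. They are read off
   the smaller of the two Gram matrices: the larger one has |m - n| additional zero eigenvalues,
   which are not singular values. *)
definition singular_values :: "real^'n^'m \<Rightarrow> real set" where
  "singular_values M =
    (if CARD('m) \<le> CARD('n)
     then {sqrt c |c. eigenvalue (M ** transpose M) c}
     else {sqrt c |c. eigenvalue (transpose M ** M) c})"

definition min_singular_value :: "real^'n^'m \<Rightarrow> real" where
  "min_singular_value M = Min (singular_values M)"

definition min_nonzero_eigenvalue :: "real^'n^'n \<Rightarrow> real" where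
  "min_nonzero_eigenvalue M = Min {c. eigenvalue M c \<and> c \<noteq> 0}"

definition orthonormal_basis_matrix :: "real^'p^'n \<Rightarrow> (real^'n) set \<Rightarrow> bool" where
  "orthonormal_basis_matrix U X \<longleftrightarrow> transpose U ** U = mat 1 \<and> span (columns U) = X"

(* Principal angles between the column spaces of U and V, for U and V with orthonormal columns.
   The number of columns is a type, so a subspace enters through a basis matrix; the angles
   do not depend on which orthonormal bases are chosen. *)
definition principal_angles :: "real^'p^'n \<Rightarrow> real^'q^'n \<Rightarrow> real set" where
  "principal_angles U V =
    {\<theta>. 0 \<le> \<theta> \<and> \<theta> \<le> pi / 2 \<and> cos \<theta> \<in> singular_values (transpose U ** V)}"

definition min_principal_angle :: "real^'p^'n \<Rightarrow> real^'q^'n \<Rightarrow> real" where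
  "min_principal_angle U V = Min (principal_angles U V)"

end

theory Submission
  imports Defs
begin

text \<open>
  Let \<open>K (x, y) = \<lambda> (x, y)\<close> with \<open>\<lambda> > 0\<close>. The second block row gives \<open>B x = \<lambda> y\<close>, so \<open>x\<close> cannot
  vanish, and pairing the first block row with \<open>x\<close> yields
  \<open>\<lambda> |x|\<^sup>2 = x \<bullet> A x + |B x|\<^sup>2 / \<lambda>\<close> (\<open>saddle_point_energy\<close>).
  Write \<open>a\<close> and \<open>b\<close> for the squared distances from \<open>x\<close> to \<open>ker A\<close> and \<open>ker B\<close>. On the orthogonal
  complement of its kernel, the quadratic form of a symmetric matrix is bounded below by one of
  its nonzero eigenvalues (\<open>quadratic_form_orthogonal_to_kernel\<close>); applied to \<open>A\<close> and to \<open>B\<^sup>T B\<close> this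
  gives \<open>x \<bullet> A x \<ge> \<mu> a\<close> and \<open>|B x|\<^sup>2 \<ge> \<sigma>\<^sup>2 b\<close>, hence \<open>\<lambda> |x|\<^sup>2 \<ge> \<mu> a + \<sigma>\<^sup>2 b / \<lambda>\<close>.

  The angle enters because a vector cannot be close to both kernels when these are far apart:
  for two subspaces whose cosines are at most \<open>c\<close>, the squared lengths of the two projections of \<open>x\<close>
  add up to at most \<open>(1 + c) |x|\<^sup>2\<close> (\<open>sum_of_two_projections\<close>), that is, \<open>a + b \<ge> (1 - c) |x|\<^sup>2\<close>.

  If \<open>\<lambda>\<close> were smaller than both \<open>\<mu> (1 - c)\<close> and \<open>\<sigma> sqrt (1 - c)\<close>, then \<open>1 - c > 0\<close>, so
  \<open>a + b > 0\<close>, and both \<open>\<mu>\<close> and \<open>\<sigma>\<^sup>2 / \<lambda>\<close> would exceed \<open>\<lambda> / (1 - c)\<close>. Therefore \<open>\<mu> a + \<sigma>\<^sup>2 b / \<lambda> > \<lambda> (a + b) / (1 - c) \<ge> \<lambda> |x|\<^sup>2\<close>, a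
  contradiction.
\<close>

section \<open>Eigenvectors of self-adjoint maps from extremal Rayleigh quotients\<close>

lemma inner_transpose_mult:
  fixes M :: "real^'n^'m"
  shows "(transpose M *v x) \<bullet> y = x \<bullet> (M *v y)"
  by (metis dot_lmul_matrix transpose_matrix_vector)

lemma inner_gram:
  fixes M :: "real^'n^'m"
  shows "x \<bullet> ((transpose M ** M) *v y) = (M *v x) \<bullet> (M *v y)"
  by (metis inner_commute inner_transpose_mult matrix_vector_mul_assoc)

text \<open>The unit sphere of a subspace is compact, so the Rayleigh quotient attains its minimum \<open>r\<close>
  at some \<open>v\<close>. Then \<open>g x = x \<bullet> f x - r (x \<bullet> x)\<close> is nonnegative on the subspace and vanishes at \<open>v\<close>;
  moving from \<open>v\<close> in the direction of the residual \<open>f v - r v\<close> would make it negative unless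
  the residual is zero. Since the subspace is invariant, the residual is an admissible direction.\<close>

lemma minimal_rayleigh_eigenvector:
  fixes f :: "'a::euclidean_space \<Rightarrow> 'a"
  assumes "linear f" "subspace S" "S \<noteq> {0}"
    and inv: "\<And>x. x \<in> S \<Longrightarrow> f x \<in> S"
    and sym: "\<And>x y. x \<bullet> f y = f x \<bullet> y"
  obtains v r where "v \<in> S" "v \<noteq> 0" "f v = r *\<^sub>R v"
    "\<And>x. x \<in> S \<Longrightarrow> r * (x \<bullet> x) \<le> x \<bullet> f x"
proof -
  interpret linear f by fact
  let ?C = "S \<inter> sphere 0 1"
  have "compact ?C"
    using assms(2) by (intro closed_Int_compact closed_subspace compact_sphere)
  moreover have "?C \<noteq> {}"
  proof -
    obtain x where x: "x \<in> S" "x \<noteq> 0"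
      using assms(2,3) subspace_0 by blast
    then have "x /\<^sub>R norm x \<in> ?C"
      using assms(2) by (simp add: subspace_scale)
    then show ?thesis by blast
  qed
  moreover have "continuous_on ?C (\<lambda>x. x \<bullet> f x)"
    by (intro continuous_intros linear_continuous_on linear_conv_bounded_linear[THEN iffD1] assms(1))
  ultimately obtain v where v: "v \<in> ?C" and min: "\<And>x. x \<in> ?C \<Longrightarrow> v \<bullet> f v \<le> x \<bullet> f x"
    using continuous_attains_inf by metis
  define r where "r = v \<bullet> f v"
  have vv: "v \<bullet> v = 1" and vS: "v \<in> S" and v0: "v \<noteq> 0"
    using v by (auto simp: norm_eq_1)
  have bound: "r * (x \<bullet> x) \<le> x \<bullet> f x" if "x \<in> S" for x
  proof (cases "x = 0")
    case False
    then have "x /\<^sub>R norm x \<in> ?C"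
      using assms(2) that by (simp add: subspace_scale)
    then have "r \<le> (x /\<^sub>R norm x) \<bullet> f (x /\<^sub>R norm x)"
      unfolding r_def by (rule min)
    also have "\<dots> = (x \<bullet> f x) / (x \<bullet> x)"
      by (simp add: scale power2_norm_eq_inner[symmetric] power2_eq_square divide_simps)
    finally show ?thesis
      using False by (simp add: field_simps)
  qed simp
  define w where "w = f v - r *\<^sub>R v"
  have wS: "w \<in> S"
    unfolding w_def using assms(2) vS inv by (simp add: subspace_diff subspace_scale)
  define G where "G = w \<bullet> f w - r * (w \<bullet> w)"
  have G0: "G \<ge> 0" using bound[OF wS] by (simp add: G_def)
  have quad: "2 * t * (w \<bullet> w) + t\<^sup>2 * G \<ge> 0" for t
  proof -
    let ?z = "v + t *\<^sub>R w"
    have "?z \<in> S"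
      using assms(2) vS wS by (simp add: subspace_add subspace_scale)
    then have "0 \<le> ?z \<bullet> f ?z - r * (?z \<bullet> ?z)"
      using bound by simp
    also have "\<dots> = 2 * t * (w \<bullet> f v - r * (w \<bullet> v)) + t\<^sup>2 * G"
      using sym[of v w] vv
      by (simp add: add scale inner_add_left inner_add_right G_def r_def[symmetric]
          inner_commute[of v w] inner_commute[of "f v" w] power2_eq_square algebra_simps)
    also have "w \<bullet> f v - r * (w \<bullet> v) = w \<bullet> w"
      by (simp add: w_def inner_diff_right inner_commute[of "f v - r *\<^sub>R v"])
    finally show ?thesis .
  qed
  have "w \<bullet> w = 0"
  proof (rule ccontr)
    assume ne: "w \<bullet> w \<noteq> 0"
    \<comment> \<open>Any small negative step contradicts \<open>quad\<close>; the \<open>+ 1\<close> covers \<open>G = 0\<close>.\<close>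
    define t where "t = - (w \<bullet> w) / (G + 1)"
    have "2 * t * (w \<bullet> w) + t\<^sup>2 * G = - ((w \<bullet> w)\<^sup>2 * (G + 2) / (G + 1)\<^sup>2)"
      using G0 by (simp add: t_def divide_simps power2_eq_square) (simp add: algebra_simps)
    moreover have "(w \<bullet> w)\<^sup>2 * (G + 2) / (G + 1)\<^sup>2 > 0"
      using G0 ne by (intro divide_pos_pos mult_pos_pos) auto
    ultimately show False using quad[of t] by linarith
  qed
  then have "f v = r *\<^sub>R v" by (simp add: w_def)
  then show ?thesis using that vS v0 bound by blast
qed

text \<open>Eigenvectors of a symmetric matrix for distinct eigenvalues are orthogonal, hence independent.\<close>

lemma finite_eigenvalues_symmetric:
  fixes M :: "real^'n^'n"
  assumes "transpose M = M"
  shows "finite {c. eigenvalue M c}"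
proof -
  define v where "v c = (SOME v. v \<noteq> 0 \<and> M *v v = c *\<^sub>R v)" for c
  have v: "v c \<noteq> 0 \<and> M *v v c = c *\<^sub>R v c" if "eigenvalue M c" for c
    unfolding v_def by (rule someI_ex) (use that in \<open>simp add: eigenvalue_def\<close>)
  have orth: "v c \<bullet> v d = 0" if "eigenvalue M c" "eigenvalue M d" "c \<noteq> d" for c d
  proof -
    have "c * (v c \<bullet> v d) = d * (v c \<bullet> v d)"
      using inner_transpose_mult[of M "v c" "v d"] v that assms by simp
    then show ?thesis using that by simp
  qed
  have "inj_on v {c. eigenvalue M c}"
    using orth v by (intro inj_onI) (metis inner_eq_zero_iff mem_Collect_eq)
  moreover have "independent (v ` {c. eigenvalue M c})"
  proof (rule pairwise_orthogonal_independent)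
    show "pairwise orthogonal (v ` {c. eigenvalue M c})"
      using orth by (fastforce simp: pairwise_def orthogonal_def)
    show "0 \<notin> v ` {c. eigenvalue M c}"
      using v by (metis (no_types, lifting) imageE mem_Collect_eq)
  qed
  ultimately show ?thesis
    using finite_imageD independent_imp_finite by blast
qed

text \<open>The orthogonal complement of the kernel is invariant, so the minimal Rayleigh quotient on it
  is an eigenvalue, and that eigenvalue is nonzero because its eigenvector is not in the kernel.\<close>

lemma quadratic_form_orthogonal_to_kernel:
  fixes M :: "real^'n^'n"
  assumes M: "transpose M = M" and "w \<noteq> 0" and w: "\<And>k. M *v k = 0 \<Longrightarrow> w \<bullet> k = 0"
  obtains r where "eigenvalue M r" "r \<noteq> 0" "r * (w \<bullet> w) \<le> w \<bullet> (M *v w)"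
proof -
  define S where "S = {x. \<forall>k. M *v k = 0 \<longrightarrow> x \<bullet> k = 0}"
  have sym: "x \<bullet> (M *v y) = (M *v x) \<bullet> y" for x y
    using inner_transpose_mult[of M x y] M by simp
  have wS: "w \<in> S" using w by (simp add: S_def)
  have "subspace S"
    by (auto simp: S_def subspace_def inner_add_left)
  moreover have "S \<noteq> {0}" using wS \<open>w \<noteq> 0\<close> by blast
  moreover have "M *v x \<in> S" if "x \<in> S" for x
    by (simp add: S_def sym[symmetric])
  ultimately obtain v r where v: "v \<in> S" "v \<noteq> 0" "M *v v = r *\<^sub>R v"
      and r: "\<And>x. x \<in> S \<Longrightarrow> r * (x \<bullet> x) \<le> x \<bullet> (M *v x)"
    using minimal_rayleigh_eigenvector[of "(*v) M" S] sym matrix_vector_mul_linear by metis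
  have "r \<noteq> 0"
  proof
    assume "r = 0"
    then have "v \<bullet> v = 0" using v by (simp add: S_def)
    then show False using v by simp
  qed
  moreover have "eigenvalue M r" using v by (auto simp: eigenvalue_def)
  ultimately show ?thesis using that r[OF wS] by blast
qed

corollary min_nonzero_eigenvalue_bound:
  fixes M :: "real^'n^'n"
  assumes M: "transpose M = M" and w: "\<And>k. M *v k = 0 \<Longrightarrow> w \<bullet> k = 0"
  shows "min_nonzero_eigenvalue M * (w \<bullet> w) \<le> w \<bullet> (M *v w)"
proof (cases "w = 0")
  case False
  then obtain r where r: "eigenvalue M r" "r \<noteq> 0" "r * (w \<bullet> w) \<le> w \<bullet> (M *v w)"
    using quadratic_form_orthogonal_to_kernel[OF M _ w] by blast
  have "min_nonzero_eigenvalue M \<le> r"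
    unfolding min_nonzero_eigenvalue_def
    using finite_eigenvalues_symmetric[OF M] r by (intro Min_le) auto
  then have "min_nonzero_eigenvalue M * (w \<bullet> w) \<le> r * (w \<bullet> w)"
    by (simp add: mult_right_mono)
  then show ?thesis using r by linarith
qed simp

section \<open>Singular values\<close>

lemma eigenvalue_gram_nonneg:
  fixes M :: "real^'n^'m"
  assumes "eigenvalue (transpose M ** M) c"
  shows "c \<ge> 0"
proof -
  obtain v where v: "v \<noteq> 0" "(transpose M ** M) *v v = c *\<^sub>R v"
    using assms by (auto simp: eigenvalue_def)
  have "c * (v \<bullet> v) = (M *v v) \<bullet> (M *v v)"
    using inner_gram[of v M v] v by simp
  then have "0 \<le> c * (v \<bullet> v)" by simp
  moreover have "v \<bullet> v > 0" using v by simp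
  ultimately show ?thesis by (metis zero_le_mult_iff not_less)
qed

lemma singular_value_nonneg: "s \<in> singular_values M \<Longrightarrow> s \<ge> 0"
  using eigenvalue_gram_nonneg[of M] eigenvalue_gram_nonneg[of "transpose M"]
  by (auto simp: singular_values_def split: if_splits)

lemma finite_singular_values: "finite (singular_values M)"
  by (simp add: singular_values_def setcompr_eq_image finite_eigenvalues_symmetric
      matrix_transpose_mul)

text \<open>If \<open>M\<^sup>T M v = r v\<close> with \<open>r \<noteq> 0\<close>, then \<open>M v\<close> is an eigenvector of \<open>M M\<^sup>T\<close>: nonzero eigenvalues
  do not depend on which of the two Gram matrices is used.\<close>

lemma sqrt_gram_eigenvalue_singular_value:
  fixes M :: "real^'n^'m"
  assumes "eigenvalue (transpose M ** M) r" "r \<noteq> 0"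
  shows "sqrt r \<in> singular_values M"
proof -
  obtain v where v: "v \<noteq> 0" "(transpose M ** M) *v v = r *\<^sub>R v"
    using assms by (auto simp: eigenvalue_def)
  have "(M ** transpose M) *v (M *v v) = M *v ((transpose M ** M) *v v)"
    by (simp add: matrix_vector_mul_assoc matrix_mul_assoc)
  also have "\<dots> = r *\<^sub>R (M *v v)"
    by (simp add: v matrix_vector_mult_scaleR)
  finally have eq: "(M ** transpose M) *v (M *v v) = r *\<^sub>R (M *v v)" .
  have "M *v v \<noteq> 0"
  proof
    assume "M *v v = 0"
    then have "r *\<^sub>R v = 0"
      using v by (simp flip: matrix_vector_mul_assoc)
    then show False using v assms by simp
  qed
  then have "eigenvalue (M ** transpose M) r"
    using eq by (auto simp: eigenvalue_def)
  then show ?thesis using assms by (auto simp: singular_values_def)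
qed

lemma min_singular_value_bound:
  fixes M :: "real^'n^'m"
  assumes "\<And>k. M *v k = 0 \<Longrightarrow> w \<bullet> k = 0"
  shows "(min_singular_value M)\<^sup>2 * (w \<bullet> w) \<le> (M *v w) \<bullet> (M *v w)"
proof (cases "w = 0")
  case False
  have "w \<bullet> k = 0" if "(transpose M ** M) *v k = 0" for k
    using inner_gram[of k M k] that assms by simp
  moreover have "transpose (transpose M ** M) = transpose M ** M"
    by (simp add: matrix_transpose_mul)
  ultimately obtain r where r: "eigenvalue (transpose M ** M) r" "r \<noteq> 0"
      "r * (w \<bullet> w) \<le> w \<bullet> ((transpose M ** M) *v w)"
    using quadratic_form_orthogonal_to_kernel[of "transpose M ** M" w] False by blast
  have s: "sqrt r \<in> singular_values M"
    using r sqrt_gram_eigenvalue_singular_value by blast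
  have "min_singular_value M \<le> sqrt r"
    unfolding min_singular_value_def using finite_singular_values s by (rule Min_le)
  moreover have "min_singular_value M \<ge> 0"
    unfolding min_singular_value_def
    using s finite_singular_values Min_in singular_value_nonneg by blast
  ultimately have "(min_singular_value M)\<^sup>2 \<le> r"
    using eigenvalue_gram_nonneg[OF r(1)] by (metis power_mono real_sqrt_pow2)
  then have "(min_singular_value M)\<^sup>2 * (w \<bullet> w) \<le> r * (w \<bullet> w)"
    by (simp add: mult_right_mono)
  then show ?thesis using r inner_gram[of w M w] by simp
qed simp

text \<open>The largest singular value is the operator norm, and it is attained: maximise the Rayleigh
  quotient of \<open>M\<^sup>T M\<close>. When the maximum is zero, \<open>M = 0\<close> and the passage between the two Gram
  matrices is not available, but then each of them vanishes.\<close>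

lemma operator_norm_singular_value:
  fixes M :: "real^'n^'m"
  obtains s v where "s \<in> singular_values M" "v \<noteq> 0" "norm (M *v v) = s * norm v"
    "\<And>x. norm (M *v x) \<le> s * norm x"
proof -
  let ?G = "transpose M ** M"
  let ?f = "\<lambda>x. - (?G *v x)"
  have "linear ?f"
    by (intro linear_compose_neg matrix_vector_mul_linear)
  moreover have "x \<bullet> ?f y = ?f x \<bullet> y" for x y
    by (metis inner_commute inner_gram inner_minus_left inner_minus_right)
  moreover have "(UNIV :: (real^'n) set) \<noteq> {0}"
    by (metis UNIV_not_singleton)
  ultimately obtain v r' where v: "v \<noteq> 0" "?f v = r' *\<^sub>R v"
      and r': "\<And>x. r' * (x \<bullet> x) \<le> x \<bullet> ?f x"
    using minimal_rayleigh_eigenvector[of ?f UNIV] subspace_UNIV by (metis UNIV_I)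
  define r where "r = - r'"
  have rv: "?G *v v = r *\<^sub>R v"
    using v(2) by (simp add: r_def minus_equation_iff[of "?G *v v"])
  have le: "(M *v x) \<bullet> (M *v x) \<le> r * (x \<bullet> x)" for x
    using r'[of x] inner_gram[of x M x] by (simp add: r_def)
  have eq: "(M *v v) \<bullet> (M *v v) = r * (v \<bullet> v)"
    using inner_gram[of v M v] rv by simp
  have ev: "eigenvalue ?G r" using v(1) rv by (auto simp: eigenvalue_def)
  then have r0: "r \<ge> 0" by (rule eigenvalue_gram_nonneg)
  have "sqrt r \<in> singular_values M"
  proof (cases "r = 0")
    case True
    then have "M *v x = 0" for x
      using le[of x] by (metis inner_gt_zero_iff mult_zero_left not_less)
    then have "(M ** transpose M) *v x = 0" for x
      by (simp flip: matrix_vector_mul_assoc)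
    moreover obtain x :: "real^'m" where "x \<noteq> 0"
      by (metis zero_neq_one)
    ultimately have "eigenvalue (M ** transpose M) r"
      using True by (auto simp: eigenvalue_def)
    then show ?thesis using ev by (auto simp: singular_values_def)
  qed (use ev sqrt_gram_eigenvalue_singular_value in blast)
  moreover have "norm (M *v v) = sqrt r * norm v"
    by (simp add: norm_eq_sqrt_inner eq real_sqrt_mult)
  moreover have "norm (M *v x) \<le> sqrt r * norm x" for x
    using le[of x] by (simp add: norm_eq_sqrt_inner flip: real_sqrt_mult)
  ultimately show ?thesis using that v(1) by blast
qed

section \<open>Projections and principal angles\<close>

lemma norm_mult_orthonormal:
  fixes U :: "real^'p^'n"
  assumes "transpose U ** U = mat 1"
  shows "norm (U *v a) = norm a"
  using inner_gram[of a U a] assms by (simp add: norm_eq_sqrt_inner)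

lemma norm_transpose_mult_orthonormal_le:
  fixes U :: "real^'p^'n"
  assumes "transpose U ** U = mat 1"
  shows "norm (transpose U *v x) \<le> norm x"
proof -
  let ?a = "transpose U *v x"
  have "norm ?a * norm ?a = x \<bullet> (U *v ?a)"
    by (metis inner_transpose_mult power2_eq_square power2_norm_eq_inner)
  also have "\<dots> \<le> norm x * norm ?a"
    using norm_cauchy_schwarz[of x "U *v ?a"] norm_mult_orthonormal[OF assms] by simp
  finally show ?thesis
    by (metis mult_le_cancel_right norm_ge_zero norm_le_zero_iff not_less order.trans)
qed

lemma orthonormal_basis_projection:
  fixes U :: "real^'p^'n"
  assumes U: "orthonormal_basis_matrix U X"
  defines "P \<equiv> \<lambda>x. U *v (transpose U *v x)"
  shows "P x \<in> X" and "k \<in> X \<Longrightarrow> (x - P x) \<bullet> k = 0"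
proof -
  have o: "transpose U ** U = mat 1" and X: "span (columns U) = X"
    using U by (auto simp: orthonormal_basis_matrix_def)
  show "P x \<in> X"
    unfolding P_def using X matrix_vector_mult_in_columnspace by blast
  assume "k \<in> X"
  then have "orthogonal (x - P x) k"
    unfolding X[symmetric]
  proof (rule orthogonal_to_span)
    fix u assume "u \<in> columns U"
    then obtain j where u: "u = U *v axis j 1"
      by (auto simp: columns_def matrix_vector_mult_basis)
    have "(x - P x) \<bullet> u = (transpose U *v (x - P x)) \<bullet> axis j 1"
      by (simp only: u inner_transpose_mult)
    also have "transpose U *v (x - P x) = 0"
      by (simp add: P_def matrix_vector_mult_diff_distrib matrix_vector_mul_assoc
          matrix_mul_assoc o)
    finally show "orthogonal (x - P x) u"
      by (simp add: orthogonal_def)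
  qed
  then show "(x - P x) \<bullet> k = 0" by (simp add: orthogonal_def)
qed

text \<open>The largest singular value of \<open>U\<^sup>T V\<close> is the cosine of an admissible angle, since it lies
  in the unit interval; the minimum angle has at least that cosine.\<close>

lemma cos_min_principal_angle:
  fixes U :: "real^'p^'n" and V :: "real^'q^'n"
  assumes U: "transpose U ** U = mat 1" and V: "transpose V ** V = mat 1"
  shows "0 \<le> cos (min_principal_angle U V)"
    and "(U *v a) \<bullet> (V *v b) \<le> cos (min_principal_angle U V) * norm (U *v a) * norm (V *v b)"
proof -
  let ?M = "transpose U ** V" and ?\<psi> = "min_principal_angle U V"
  obtain s v where s: "s \<in> singular_values ?M" and v: "v \<noteq> 0" "norm (?M *v v) = s * norm v"
      and le: "\<And>x. norm (?M *v x) \<le> s * norm x"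
    by (rule operator_norm_singular_value[of ?M]) blast
  have "norm (?M *v v) \<le> norm v"
    using norm_transpose_mult_orthonormal_le[OF U, of "V *v v"] norm_mult_orthonormal[OF V]
    by (simp add: matrix_vector_mul_assoc)
  then have s1: "s \<le> 1" using v by simp
  have s0: "s \<ge> 0" using s by (rule singular_value_nonneg)
  have fin: "finite (principal_angles U V)"
  proof (rule finite_imageD)
    show "finite (cos ` principal_angles U V)"
      by (rule finite_subset[OF _ finite_singular_values[of ?M]])
        (auto simp: principal_angles_def)
    show "inj_on cos (principal_angles U V)"
      by (auto simp: inj_on_def principal_angles_def intro: cos_inj_pi)
  qed
  have arc: "arccos s \<in> principal_angles U V"
    using s s0 s1 arccos_le_pi2[of s] by (simp add: principal_angles_def arccos_lbound)
  have \<psi>: "?\<psi> \<in> principal_angles U V" "?\<psi> \<le> arccos s"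
    unfolding min_principal_angle_def using fin arc by (auto intro: Min_in)
  have "cos (arccos s) \<le> cos ?\<psi>"
    using \<psi> s0 s1 by (intro cos_monotone_0_pi_le) (auto simp: principal_angles_def arccos_ubound)
  then have sc: "s \<le> cos ?\<psi>" using s0 s1 by simp
  then show "0 \<le> cos ?\<psi>" using s0 by linarith
  have "(U *v a) \<bullet> (V *v b) = a \<bullet> (?M *v b)"
    by (metis inner_commute inner_transpose_mult matrix_vector_mul_assoc)
  also have "\<dots> \<le> norm a * norm (?M *v b)" by (rule norm_cauchy_schwarz)
  also have "\<dots> \<le> norm a * (s * norm b)" using le by (simp add: mult_left_mono)
  also have "\<dots> \<le> norm a * (cos ?\<psi> * norm b)" using sc by (simp add: mult_left_mono mult_right_mono)
  finally show "(U *v a) \<bullet> (V *v b) \<le> cos ?\<psi> * norm (U *v a) * norm (V *v b)"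
    using norm_mult_orthonormal[OF U] norm_mult_orthonormal[OF V] by (simp add: mult_ac)
qed

text \<open>Here \<open>u\<close> and \<open>v\<close> stand for projections of \<open>x\<close>, so \<open>t = |u|\<^sup>2 + |v|\<^sup>2\<close> equals \<open>x \<bullet> (u + v)\<close>.
  Since \<open>|u + v|\<^sup>2 \<le> (1 + c) t\<close> by the angle condition and \<open>2 |u| |v| \<le> t\<close>, Cauchy-Schwarz gives
  \<open>t\<^sup>2 \<le> |x|\<^sup>2 (1 + c) t\<close>.\<close>

lemma sum_of_two_projections:
  fixes x u v :: "'a::real_inner"
  assumes u: "(x - u) \<bullet> u = 0" and v: "(x - v) \<bullet> v = 0"
    and c: "0 \<le> c" "u \<bullet> v \<le> c * norm u * norm v"
  shows "u \<bullet> u + v \<bullet> v \<le> (1 + c) * (x \<bullet> x)"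
proof -
  define t where "t = u \<bullet> u + v \<bullet> v"
  have t: "t = x \<bullet> (u + v)"
    using u v by (simp add: t_def inner_diff_left inner_add_right)
  have "2 * (norm u * norm v) \<le> t"
    using sum_squares_bound[of "norm u" "norm v"] by (simp add: t_def power2_norm_eq_inner)
  then have "c * (2 * (norm u * norm v)) \<le> c * t"
    using c(1) by (rule mult_left_mono)
  then have uv: "(u + v) \<bullet> (u + v) \<le> (1 + c) * t"
    using c(2) by (simp add: t_def inner_add_left inner_add_right inner_commute[of v u] algebra_simps)
  have "t * t \<le> (x \<bullet> x) * ((u + v) \<bullet> (u + v))"
    using Cauchy_Schwarz_ineq[of x "u + v"] by (simp add: t power2_eq_square)
  also have "\<dots> \<le> (x \<bullet> x) * ((1 + c) * t)" using uv by (rule mult_left_mono) simp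
  finally have "t * t \<le> ((1 + c) * (x \<bullet> x)) * t" by (simp add: mult_ac)
  moreover have "t \<ge> 0" by (simp add: t_def)
  ultimately have "t \<le> (1 + c) * (x \<bullet> x)"
    using c(1) by (cases "t = 0") auto
  then show ?thesis by (simp add: t_def)
qed

section \<open>Eigenvectors of the block matrix\<close>

lemma block_matrix_mult:
  fixes P :: "real^'n^'k" and Q :: "real^'m^'k" and R :: "real^'n^'l" and S :: "real^'m^'l"
    and z :: "real^('n + 'm)"
  defines "x \<equiv> \<chi> i. z $ Inl i" and "y \<equiv> \<chi> i. z $ Inr i"
  shows "(block_matrix P Q R S *v z) $ Inl i = (P *v x + Q *v y) $ i"
    and "(block_matrix P Q R S *v z) $ Inr j = (R *v x + S *v y) $ j"
proof -
  have split: "(\<Sum>k\<in>UNIV. g k) = (\<Sum>k\<in>UNIV. g (Inl k)) + (\<Sum>k\<in>UNIV. g (Inr k))"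
    for g :: "'n + 'm \<Rightarrow> real"
    using sum.Plus[of "UNIV :: 'n set" "UNIV :: 'm set" g] by (simp add: UNIV_Plus_UNIV comp_def)
  show "(block_matrix P Q R S *v z) $ Inl i = (P *v x + Q *v y) $ i"
    and "(block_matrix P Q R S *v z) $ Inr j = (R *v x + S *v y) $ j"
    by (simp_all add: matrix_vector_mult_def block_matrix_def x_def y_def split)
qed

text \<open>Eliminating \<open>y = B x / c\<close> from the two block rows.\<close>

lemma saddle_point_energy:
  fixes A :: "real^'n^'n" and B :: "real^'n^'m"
  assumes "eigenvalue (block_matrix A (transpose B) B 0) c" and "c \<noteq> 0"
  obtains x where "x \<noteq> 0" "c * (x \<bullet> x) = x \<bullet> (A *v x) + (B *v x) \<bullet> (B *v x) / c"
proof -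
  obtain z where z: "z \<noteq> 0" "block_matrix A (transpose B) B 0 *v z = c *\<^sub>R z"
    using assms(1) by (auto simp: eigenvalue_def)
  define x :: "real^'n" where "x = (\<chi> i. z $ Inl i)"
  define y :: "real^'m" where "y = (\<chi> i. z $ Inr i)"
  have row1: "A *v x + transpose B *v y = c *\<^sub>R x"
    using block_matrix_mult(1)[of A "transpose B" B 0 z]
    by (simp add: vec_eq_iff z(2) x_def[symmetric] y_def[symmetric]) (simp add: x_def)
  have row2: "B *v x = c *\<^sub>R y"
    using block_matrix_mult(2)[of A "transpose B" B 0 z]
    by (simp add: vec_eq_iff z(2) x_def[symmetric] y_def[symmetric]) (simp add: y_def)
  have "x \<noteq> 0"
  proof
    assume x0: "x = 0"
    then have "y = 0" using row2 assms(2) by simp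
    then have "z $ i = 0" for i
      using x0 by (cases i) (simp_all add: x_def y_def vec_eq_iff)
    then show False using z(1) by (simp add: vec_eq_iff)
  qed
  moreover have "c * (x \<bullet> x) = x \<bullet> (A *v x) + (B *v x) \<bullet> (B *v x) / c"
  proof -
    have "c * (x \<bullet> x) = x \<bullet> (A *v x + transpose B *v y)"
      by (simp only: row1 inner_scaleR_right)
    also have "x \<bullet> (transpose B *v y) = y \<bullet> (B *v x)"
      by (metis inner_commute inner_transpose_mult)
    then have "x \<bullet> (A *v x + transpose B *v y) = x \<bullet> (A *v x) + y \<bullet> (B *v x)"
      by (simp add: inner_add_right)
    finally show ?thesis using assms(2) by (simp add: row2)
  qed
  ultimately show ?thesis using that by blast
qed

theorem corollary7:
  fixes A :: "real^'n^'n"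
    and B :: "real^'n^'m"
    and U :: "real^'p^'n"
    and V :: "real^'q^'n"
    and K :: "real^('n + 'm)^('n + 'm)"
    and \<psi> :: real
  assumes "CARD('m) < CARD('n)"
    and "positive_semidefinite A"
    and "rank A = CARD('n) - CARD('m)"
    and "rank B = CARD('m)"
    and "K = block_matrix A (transpose B) B 0"
    and "invertible K"
    and "orthonormal_basis_matrix U (matrix_kernel A)"
    and "orthonormal_basis_matrix V (matrix_kernel B)"
    and "\<psi> = min_principal_angle U V"
  shows "\<forall>c. eigenvalue K c \<and> c > 0 \<longrightarrow>
           c \<ge> min (min_nonzero_eigenvalue A * (1 - cos \<psi>))
                   (min_singular_value B * sqrt (1 - cos \<psi>))"
proof (intro allI impI)
  fix c assume "eigenvalue K c \<and> c > 0"
  then have ev: "eigenvalue (block_matrix A (transpose B) B 0) c" and c0: "c > 0"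
    using assms(5) by auto
  define \<mu> where "\<mu> = min_nonzero_eigenvalue A"
  define \<sigma> where "\<sigma> = min_singular_value B"
  define d where "d = 1 - cos \<psi>"
  have sym: "transpose A = A" using assms(2) by (simp add: positive_semidefinite_def)
  obtain x where x0: "x \<noteq> 0"
      and energy: "c * (x \<bullet> x) = x \<bullet> (A *v x) + (B *v x) \<bullet> (B *v x) / c"
    using saddle_point_energy[OF ev] c0 by (metis less_irrefl)
  define u where "u = U *v (transpose U *v x)"
  define v where "v = V *v (transpose V *v x)"
  have u: "A *v u = 0" "\<And>k. A *v k = 0 \<Longrightarrow> (x - u) \<bullet> k = 0"
    using orthonormal_basis_projection[OF assms(7), where x = x]
    by (auto simp: u_def matrix_kernel_def)
  have v: "B *v v = 0" "\<And>k. B *v k = 0 \<Longrightarrow> (x - v) \<bullet> k = 0"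
    using orthonormal_basis_projection[OF assms(8), where x = x]
    by (auto simp: v_def matrix_kernel_def)
  define a where "a = (x - u) \<bullet> (x - u)"
  define b where "b = (x - v) \<bullet> (x - v)"
  have ab0: "a \<ge> 0" "b \<ge> 0" by (simp_all add: a_def b_def)
  have "u \<bullet> u + v \<bullet> v \<le> (1 + cos \<psi>) * (x \<bullet> x)"
  proof (rule sum_of_two_projections)
    have "transpose U ** U = mat 1" "transpose V ** V = mat 1"
      using assms(7,8) by (auto simp: orthonormal_basis_matrix_def)
    from cos_min_principal_angle[OF this]
    show "0 \<le> cos \<psi>" "u \<bullet> v \<le> cos \<psi> * norm u * norm v"
      by (simp_all add: assms(9) u_def v_def)
  qed (use u v in auto)
  moreover have "a = x \<bullet> x - u \<bullet> u"
    using u(2)[OF u(1)] by (simp add: a_def inner_diff_left inner_diff_right inner_commute)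
  moreover have "b = x \<bullet> x - v \<bullet> v"
    using v(2)[OF v(1)] by (simp add: b_def inner_diff_left inner_diff_right inner_commute)
  ultimately have far: "d * (x \<bullet> x) \<le> a + b"
    by (simp add: d_def algebra_simps)
  have "x \<bullet> (A *v x) = (x - u) \<bullet> (A *v (x - u))"
    using u(1) inner_transpose_mult[of A u x]
    by (simp add: sym matrix_vector_mult_diff_distrib inner_diff_left)
  then have A_part: "\<mu> * a \<le> x \<bullet> (A *v x)"
    using min_nonzero_eigenvalue_bound[OF sym u(2)] by (simp add: \<mu>_def a_def)
  have B_part: "\<sigma>\<^sup>2 * b \<le> (B *v x) \<bullet> (B *v x)"
    using min_singular_value_bound[of B "x - v", OF v(2)] v(1)
    by (simp add: \<sigma>_def b_def matrix_vector_mult_diff_distrib)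
  show "c \<ge> min (min_nonzero_eigenvalue A * (1 - cos \<psi>))
                (min_singular_value B * sqrt (1 - cos \<psi>))"
  proof (rule ccontr)
    assume "\<not> ?thesis"
    then have less: "c < \<mu> * d" "c < \<sigma> * sqrt d"
      by (auto simp: \<mu>_def \<sigma>_def d_def)
    \<comment> \<open>A zero minimum angle makes the claimed bound trivial, so it cannot be violated.\<close>
    have "d \<noteq> 0" using less(1) c0 by auto
    then have d0: "d > 0" by (simp add: d_def less_le)
    have ab: "a + b > 0"
      using far d0 x0 by (smt (verit) inner_gt_zero_iff mult_pos_pos)
    have mu: "c / d < \<mu>" using less(1) d0 by (simp add: field_simps)
    have "c\<^sup>2 < (\<sigma> * sqrt d)\<^sup>2" using less(2) c0 by (intro power_strict_mono) auto
    then have sigma: "c / d < \<sigma>\<^sup>2 / c"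
      using d0 c0 by (simp add: power_mult_distrib field_simps power2_eq_square)
    have "c * (x \<bullet> x) \<le> c / d * (a + b)"
      using mult_left_mono[OF far, of "c / d"] d0 c0 by (simp add: field_simps)
    also have "\<dots> < \<mu> * a + \<sigma>\<^sup>2 / c * b"
    proof (cases "a = 0")
      case True
      then show ?thesis using ab mult_strict_right_mono[OF sigma, of b] by simp
    next
      case False
      then show ?thesis
        using ab0 mult_strict_right_mono[OF mu, of a] mult_right_mono[OF less_imp_le[OF sigma], of b]
        by (simp add: distrib_left)
    qed
    also have "\<dots> \<le> x \<bullet> (A *v x) + (B *v x) \<bullet> (B *v x) / c"
      using A_part divide_right_mono[OF B_part, of c] c0 by simp
    finally show False using energy by simp
  qed
qed

end
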